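(* Let $S$ be a commutative local ring with involution $*$, and let $R=\{a\in S:a^*=a\}$. Let $V$ be a free $S$-module of rank $2m$ ($m\ge1$) with a nondegenerate skew hermitian form $h:V\times V\to S$, and assume that $V$ has a symplectic basis $u_1,v_1,\dots,u_m,v_m$. Then the set $$\{f_{a,v}: a\in R,\ v\in V \text{ a basis vector with } h(v,v)=0\}$$ is a generating set for the group $SU(V)$.
   Context: An involution of a commutative ring is a ring automorphism $*$ with $a^{**}=a$ (possibly trivial). A skew hermitian form $h$ is additive in each variable, $S$-linear in the second variable, and satisfies $h(u,v)^*=-h(v,u)$. A basis $u_1,v_1,\dots,u_m,v_m$ of $V$ is symplectic if $h(u_i,v_i)=1$ for all $i$, $h(u_i,u_j)=h(v_i,v_j)=0$ for all $i,j$, and $h(u_i,v_j)=0$ for $i\ne j$. A vector of $V$ is a basis vector if it belongs to some $S$-basis of $V$. $U(V)$ is the group of $S$-linear automorphisms $g$ of $V$ with $h(gu,gv)=h(u,v)$ for all $u,v$, and $SU(V)=\{g\in U(V):\det g=1\}$. For $a\in S$ and $v\in V$, $f_{a,v}:V\to V$ is defined by $f_{a,v}(u)=u+a\,h(v,u)\,v$; when $a\in R$ and $h(v,v)=0$ it belongs to $SU(V)$. *)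

theory Defs
  imports
    "Jordan_Normal_Form.Determinant"
    "HOL-Algebra.Generated_Groups"
begin

text \<open>
  The ring \<open>S\<close> is a type of class \<open>comm_ring_1\<close>, and the \<open>S\<close>-module \<open>V\<close> is a type of class
  \<open>ab_group_add\<close> with a scalar multiplication \<open>scale\<close> satisfying the locale \<open>module\<close> of
  \<open>HOL.Modules\<close>. That locale is always written with its qualifier, because \<open>HOL-Algebra\<close> has a
  locale of the same name.
\<close>


subsection \<open>Local rings with involution\<close>

text \<open>The ideals of a commutative ring are its submodules, as a module over itself.\<close>

definition ring_ideal :: "'s::comm_ring_1 set \<Rightarrow> bool" where
  "ring_ideal I \<longleftrightarrow> Modules.module.subspace (*) I"

definition maximal_ring_ideal :: "'s::comm_ring_1 set \<Rightarrow> bool" where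
  "maximal_ring_ideal I \<longleftrightarrow> ring_ideal I \<and> I \<noteq> UNIV \<and>
     (\<forall>J. ring_ideal J \<and> I \<subseteq> J \<longrightarrow> J = I \<or> J = UNIV)"

definition local_ring :: "'s::comm_ring_1 itself \<Rightarrow> bool" where
  "local_ring _ \<longleftrightarrow> (\<exists>!I :: 's set. maximal_ring_ideal I)"

definition ring_involution :: "('s::comm_ring_1 \<Rightarrow> 's) \<Rightarrow> bool" where
  "ring_involution star \<longleftrightarrow> bij star \<and>
     (\<forall>a b. star (a + b) = star a + star b) \<and>
     (\<forall>a b. star (a * b) = star a * star b) \<and>
     star 1 = 1 \<and>
     (\<forall>a. star (star a) = a)"

definition fixed_ring :: "('s \<Rightarrow> 's) \<Rightarrow> 's set" where
  "fixed_ring star = {a. star a = a}"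


subsection \<open>Bases and determinants\<close>

definition is_basis :: "('s::comm_ring_1 \<Rightarrow> 'v::ab_group_add \<Rightarrow> 'v) \<Rightarrow> 'v set \<Rightarrow> bool" where
  "is_basis scale B \<longleftrightarrow>
     \<not> Modules.module.dependent scale B \<and> Modules.module.span scale B = UNIV"

definition ordered_basis :: "('s::comm_ring_1 \<Rightarrow> 'v::ab_group_add \<Rightarrow> 'v) \<Rightarrow> 'v list \<Rightarrow> bool" where
  "ordered_basis scale bs \<longleftrightarrow> distinct bs \<and> is_basis scale (set bs)"

definition free_of_rank :: "('s::comm_ring_1 \<Rightarrow> 'v::ab_group_add \<Rightarrow> 'v) \<Rightarrow> nat \<Rightarrow> bool" where
  "free_of_rank scale n \<longleftrightarrow> (\<exists>bs. ordered_basis scale bs \<and> length bs = n)"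

definition basis_vector :: "('s::comm_ring_1 \<Rightarrow> 'v::ab_group_add \<Rightarrow> 'v) \<Rightarrow> 'v \<Rightarrow> bool" where
  "basis_vector scale v \<longleftrightarrow> (\<exists>B. is_basis scale B \<and> v \<in> B)"

text \<open>Column \<open>j\<close> lists the coordinates of \<open>g (bs ! j)\<close> in the basis \<open>bs\<close>.\<close>

definition matrix_of ::
  "('s::comm_ring_1 \<Rightarrow> 'v::ab_group_add \<Rightarrow> 'v) \<Rightarrow> 'v list \<Rightarrow> ('v \<Rightarrow> 'v) \<Rightarrow> 's mat" where
  "matrix_of scale bs g = mat (length bs) (length bs)
     (\<lambda>(i, j). Modules.module.representation scale (set bs) (g (bs ! j)) (bs ! i))"

text \<open>
  The determinant of an endomorphism of a free module of finite rank. The choice of the basis is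
  immaterial, since matrices with respect to different bases are similar. If there is no finite
  basis, the value is meaningless.
\<close>

definition lin_det ::
  "('s::comm_ring_1 \<Rightarrow> 'v::ab_group_add \<Rightarrow> 'v) \<Rightarrow> ('v \<Rightarrow> 'v) \<Rightarrow> 's" where
  "lin_det scale g = det (matrix_of scale (SOME bs. ordered_basis scale bs) g)"


subsection \<open>Skew hermitian forms\<close>

definition skew_hermitian ::
  "('s::comm_ring_1 \<Rightarrow> 'v::ab_group_add \<Rightarrow> 'v) \<Rightarrow> ('s \<Rightarrow> 's) \<Rightarrow> ('v \<Rightarrow> 'v \<Rightarrow> 's) \<Rightarrow> bool" where
  "skew_hermitian scale star h \<longleftrightarrow>
     (\<forall>u u' v. h (u + u') v = h u v + h u' v) \<and>
     (\<forall>u. Modules.module_hom scale (*) (h u)) \<and>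
     (\<forall>u v. star (h u v) = - h v u)"

text \<open>The map \<open>v \<mapsto> h(v, -)\<close> is a bijection from \<open>V\<close> onto its dual module.\<close>

definition nondegenerate ::
  "('s::comm_ring_1 \<Rightarrow> 'v::ab_group_add \<Rightarrow> 'v) \<Rightarrow> ('v \<Rightarrow> 'v \<Rightarrow> 's) \<Rightarrow> bool" where
  "nondegenerate scale h \<longleftrightarrow> bij_betw h UNIV {\<phi>. Modules.module_hom scale (*) \<phi>}"

text \<open>The vectors \<open>u\<^sub>1, v\<^sub>1, \<dots>, u\<^sub>m, v\<^sub>m\<close> are \<open>u 0, v 0, \<dots>, u (m - 1), v (m - 1)\<close>.\<close>

definition symplectic_basis ::
  "('s::comm_ring_1 \<Rightarrow> 'v::ab_group_add \<Rightarrow> 'v) \<Rightarrow> ('v \<Rightarrow> 'v \<Rightarrow> 's) \<Rightarrow>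
   nat \<Rightarrow> (nat \<Rightarrow> 'v) \<Rightarrow> (nat \<Rightarrow> 'v) \<Rightarrow> bool" where
  "symplectic_basis scale h m u v \<longleftrightarrow>
     ordered_basis scale (concat (map (\<lambda>i. [u i, v i]) [0..<m])) \<and>
     (\<forall>i<m. h (u i) (v i) = 1) \<and>
     (\<forall>i<m. \<forall>j<m. h (u i) (u j) = 0 \<and> h (v i) (v j) = 0) \<and>
     (\<forall>i<m. \<forall>j<m. i \<noteq> j \<longrightarrow> h (u i) (v j) = 0)"


subsection \<open>Unitary groups\<close>

definition unitary_maps ::
  "('s::comm_ring_1 \<Rightarrow> 'v::ab_group_add \<Rightarrow> 'v) \<Rightarrow> ('v \<Rightarrow> 'v \<Rightarrow> 's) \<Rightarrow> ('v \<Rightarrow> 'v) set" where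
  "unitary_maps scale h =
     {g. Modules.module_hom scale scale g \<and> bij g \<and> (\<forall>u v. h (g u) (g v) = h u v)}"

definition SU ::
  "('s::comm_ring_1 \<Rightarrow> 'v::ab_group_add \<Rightarrow> 'v) \<Rightarrow> ('v \<Rightarrow> 'v \<Rightarrow> 's) \<Rightarrow> ('v \<Rightarrow> 'v) monoid" where
  "SU scale h =
     \<lparr>carrier = {g \<in> unitary_maps scale h. lin_det scale g = 1}, mult = (\<circ>), one = id\<rparr>"

definition transvection ::
  "('s::comm_ring_1 \<Rightarrow> 'v::ab_group_add \<Rightarrow> 'v) \<Rightarrow> ('v \<Rightarrow> 'v \<Rightarrow> 's) \<Rightarrow> 's \<Rightarrow> 'v \<Rightarrow> 'v \<Rightarrow> 'v" where
  "transvection scale h a v = (\<lambda>u. u + scale (a * h v u) v)"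

definition isotropic_transvections ::
  "('s::comm_ring_1 \<Rightarrow> 'v::ab_group_add \<Rightarrow> 'v) \<Rightarrow> ('s \<Rightarrow> 's) \<Rightarrow> ('v \<Rightarrow> 'v \<Rightarrow> 's) \<Rightarrow>
   ('v \<Rightarrow> 'v) set" where
  "isotropic_transvections scale star h =
     {transvection scale h a v | a v. a \<in> fixed_ring star \<and> basis_vector scale v \<and> h v v = 0}"

definition generating_set :: "('a, 'b) monoid_scheme \<Rightarrow> 'a set \<Rightarrow> bool" where
  "generating_set G X \<longleftrightarrow> X \<subseteq> carrier G \<and> generate G X = carrier G"

end

theory Submission
  imports Defs
begin

text \<open>
  Let \<open>T\<close> be the group generated by the isotropic transvections. A transvection adds to the
  identity a map of rank one with trace \<open>a h(v,v) = 0\<close>, so its determinant is \<open>1\<close> and \<open>T\<close> lies in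
  \<open>SU(V)\<close>. For the converse, \<open>g \<in> SU(V)\<close> is multiplied by elements of \<open>T\<close> until it fixes the whole
  symplectic basis, one hyperbolic pair \<open>u\<^sub>k, v\<^sub>k\<close> at a time, starting from the last one.

  The supply of elements of \<open>T\<close> grows by one observation: for orthogonal isotropic \<open>x, y\<close> the
  product \<open>f\<^bsub>1,x+sy\<^esub> f\<^bsub>-1,x\<^esub> f\<^bsub>-ss*,y\<^esub>\<close> is the Eichler map
  \<open>z \<mapsto> z + s h(x,z) y + s* h(y,z) x\<close>, where \<open>s\<close> may be any scalar of \<open>S\<close> and not only of \<open>R\<close>
  (\<open>eichler_in_T\<close>). With it comes the main tool (\<open>move_fixing\<close>): if \<open>x\<close> is a vector of the symplectic
  basis and \<open>z, w\<close> are isotropic with \<open>h(x,z) = h(x,w)\<close> a unit, then some element of \<open>T\<close> fixes \<open>x\<close>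
  and takes \<open>z\<close> to \<open>w\<close>. Eichler maps with \<open>x\<close> as one of the two vectors correct \<open>z\<close> up to a
  multiple of \<open>x\<close>; isotropy of both vectors forces the remaining coefficient, divided by the unit,
  to lie in \<open>R\<close>, so one transvection along \<open>x\<close> finishes.

  The image \<open>z = g u\<^sub>k\<close> has a unit coordinate because the nonunits of a local ring are closed under
  addition. If \<open>k > 0\<close>, a second hyperbolic plane is available, and a few moves through an
  auxiliary plane bring \<open>z\<close> to \<open>u\<^sub>k\<close>. A further move, fixing \<open>u\<^sub>k\<close>, then brings the image of \<open>v\<^sub>k\<close>
  to \<open>v\<^sub>k\<close>. In the last plane there is no room for this: \<open>z\<close> can only be brought to \<open>a u\<^sub>0\<close> with a
  unit \<open>a\<close>, and then the map becomes \<open>diag(a, d)\<close> with \<open>a* d = 1\<close>. Here alone the determinant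
  matters: \<open>a d = 1\<close> gives \<open>a = a*\<close>, and for \<open>a \<in> R\<close> three moves take \<open>a u\<^sub>0\<close> to \<open>u\<^sub>0\<close>.
\<close>

section \<open>Local rings\<close>

lemma module_ring_mult: "Modules.module ((*) :: 's::comm_ring_1 \<Rightarrow> 's \<Rightarrow> 's)"
  by standard (simp_all add: algebra_simps)

lemma ring_ideal_iff:
  "ring_ideal (I :: 's::comm_ring_1 set) \<longleftrightarrow>
     0 \<in> I \<and> (\<forall>x\<in>I. \<forall>y\<in>I. x + y \<in> I) \<and> (\<forall>c. \<forall>x\<in>I. c * x \<in> I)"
  unfolding ring_ideal_def by (rule module.subspace_def[OF module_ring_mult])

lemma ideal_eq_UNIV_iff:
  assumes "ring_ideal (I :: 's::comm_ring_1 set)"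
  shows "I = UNIV \<longleftrightarrow> 1 \<in> I"
proof
  assume "1 \<in> I"
  then have "c * 1 \<in> I" for c using assms unfolding ring_ideal_iff by blast
  then show "I = UNIV" by auto
qed simp

text \<open>
  The ideals that contain \<open>a\<close> but not \<open>1\<close> include \<open>a S\<close> and are closed under unions of chains; a
  maximal one among them is a maximal ideal.
\<close>

lemma nonunit_in_maximal_ideal:
  fixes a :: "'s::comm_ring_1"
  assumes "\<not> a dvd 1"
  shows "\<exists>M. maximal_ring_ideal M \<and> a \<in> M"
proof -
  let ?A = "{J. ring_ideal J \<and> a \<in> J \<and> 1 \<notin> J}"
  have "range ((*) a) \<in> ?A"
  proof -
    have "ring_ideal (range ((*) a))"
      unfolding ring_ideal_iff
      by (auto simp: image_iff) (metis mult_zero_right distrib_left mult.left_commute)+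
    moreover have "a \<in> range ((*) a)" by (metis mult_1_right rangeI)
    moreover have "1 \<notin> range ((*) a)" using assms by (metis dvdI rangeE)
    ultimately show ?thesis by simp
  qed
  then have "?A \<noteq> {}" by blast
  then have "\<exists>M\<in>?A. \<forall>X\<in>?A. M \<subseteq> X \<longrightarrow> X = M"
  proof (rule subset_Zorn_nonempty)
    fix C assume C: "C \<noteq> {}" "subset.chain ?A C"
    then have mem: "\<And>J. J \<in> C \<Longrightarrow> J \<in> ?A" and tot: "\<And>J K. J \<in> C \<Longrightarrow> K \<in> C \<Longrightarrow> J \<subseteq> K \<or> K \<subseteq> J"
      by (auto simp: subset_chain_def)
    have "ring_ideal (\<Union>C)" unfolding ring_ideal_iff
    proof (intro conjI ballI allI)
      show "0 \<in> \<Union>C" using C(1) mem by (auto simp: ring_ideal_iff)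
    next
      fix x y assume "x \<in> \<Union>C" "y \<in> \<Union>C"
      then obtain J K where "J \<in> C" "x \<in> J" "K \<in> C" "y \<in> K" by blast
      then obtain L where "L \<in> C" "x \<in> L" "y \<in> L" using tot by blast
      then show "x + y \<in> \<Union>C" using mem[of L] by (auto simp: ring_ideal_iff)
    next
      fix c x assume "x \<in> \<Union>C"
      then show "c * x \<in> \<Union>C" using mem by (auto simp: ring_ideal_iff)
    qed
    then show "\<Union>C \<in> ?A" using C(1) mem by auto
  qed
  then obtain M where M: "ring_ideal M" "a \<in> M" "1 \<notin> M"
    and max: "\<And>X. ring_ideal X \<Longrightarrow> a \<in> X \<Longrightarrow> 1 \<notin> X \<Longrightarrow> M \<subseteq> X \<Longrightarrow> X = M" by auto
  have "maximal_ring_ideal M"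
    unfolding maximal_ring_ideal_def using M max ideal_eq_UNIV_iff by blast
  then show ?thesis using M by blast
qed

text \<open>
  Maximal ideals containing \<open>a\<close> and \<open>b\<close> coincide, so this ideal contains \<open>a + b\<close> as well.
\<close>

lemma local_ring_nonunit_add:
  fixes a b :: "'s::comm_ring_1"
  assumes "local_ring TYPE('s)" "\<not> a dvd 1" "\<not> b dvd 1"
  shows "\<not> (a + b) dvd 1"
proof
  assume unit: "(a + b) dvd 1"
  obtain M where M: "maximal_ring_ideal M" "a \<in> M" "b \<in> M"
    using assms nonunit_in_maximal_ideal unfolding local_ring_def by blast
  have I: "ring_ideal M" and "M \<noteq> UNIV" using M(1) by (simp_all add: maximal_ring_ideal_def)
  obtain c where c: "(a + b) * c = 1" using unit by (metis dvdE)
  have "c * (a + b) \<in> M" using I M(2,3) unfolding ring_ideal_iff by blast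
  then have "1 \<in> M" using c by (simp add: mult.commute)
  then show False using ideal_eq_UNIV_iff[OF I] \<open>M \<noteq> UNIV\<close> by blast
qed

section \<open>Determinants of endomorphisms\<close>

text \<open>
  Multiplying the block matrix with blocks \<open>1, - P, X, 1\<close> by the unipotent block matrix with blocks
  \<open>1, 0, - X, 1\<close> on the left or on the right produces block triangular matrices with the two
  determinants in question, and these products have equal determinants.
\<close>

lemma det_one_plus_rank_one:
  fixes X P :: "'s::comm_ring_1 mat"
  assumes X: "X \<in> carrier_mat n 1" and P: "P \<in> carrier_mat 1 n"
  shows "det (1\<^sub>m n + X * P) = det (1\<^sub>m 1 + P * X)"
proof -
  let ?M = "four_block_mat (1\<^sub>m 1) (- P) X (1\<^sub>m n)"
  let ?L = "four_block_mat (1\<^sub>m 1) (0\<^sub>m 1 n) (- X) (1\<^sub>m n)"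
  have M: "?M \<in> carrier_mat (1 + n) (1 + n)" and L: "?L \<in> carrier_mat (1 + n) (1 + n)"
    by (rule four_block_carrier_mat; simp)+
  have XP: "X * P \<in> carrier_mat n n" and PX: "P * X \<in> carrier_mat 1 1" using X P by auto
  have neg: "- X * - P = X * P" "- P * - X = P * X" using X P by auto
  have left: "?L * ?M = four_block_mat (1\<^sub>m 1) (- P) (0\<^sub>m n 1) (1\<^sub>m n + X * P)"
    by (subst mult_four_block_mat[of _ 1 1 _ n _ n _ _ 1 _ n])
      (use X P XP in \<open>auto simp: neg intro!: cong_four_block_mat comm_add_mat\<close>)
  have right: "?M * ?L = four_block_mat (1\<^sub>m 1 + P * X) (- P) (0\<^sub>m n 1) (1\<^sub>m n)"
    by (subst mult_four_block_mat[of _ 1 1 _ n _ n _ _ 1 _ n])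
      (use X P PX in \<open>auto simp: neg intro!: cong_four_block_mat\<close>)
  have "det (1\<^sub>m n + X * P) = det (?L * ?M)"
    unfolding left by (subst det_four_block_mat_lower_left_zero_col[of _ _ n]) (use X P XP in auto)
  also have "\<dots> = det (?M * ?L)"
    unfolding det_mult[OF L M] det_mult[OF M L] by (rule mult.commute)
  also have "\<dots> = det (1\<^sub>m 1 + P * X)"
    unfolding right by (subst det_four_block_mat_lower_left_zero_col[of _ _ n]) (use X P PX in auto)
  finally show ?thesis .
qed

context Modules.module begin

lemma matrix_of_comp:
  assumes bs: "ordered_basis scale bs"
    and f: "Modules.module_hom scale scale f" and g: "Modules.module_hom scale scale g"
  shows "matrix_of scale bs (g \<circ> f) = matrix_of scale bs g * matrix_of scale bs f"
proof -
  interpret g: Modules.module_hom scale scale g by fact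
  let ?r = "representation (set bs)"
  have ind: "independent (set bs)" and sp: "\<And>x. x \<in> span (set bs)" and d: "distinct bs"
    using bs by (auto simp: ordered_basis_def is_basis_def)
  have *: "?r (g x) b = (\<Sum>k<length bs. ?r (g (bs ! k)) b * ?r x (bs ! k))" for x b
  proof -
    have x: "x = (\<Sum>c\<in>set bs. scale (?r x c) c)"
      using sum_representation_eq[OF ind sp] by simp
    have "?r (g x) b = (\<Sum>c\<in>set bs. ?r x c * ?r (g c) b)"
      by (subst x) (simp add: g.sum g.scale representation_sum[OF ind] representation_scale[OF ind] sp)
    also have "\<dots> = (\<Sum>k<length bs. ?r x (bs ! k) * ?r (g (bs ! k)) b)"
      by (rule sum.reindex_bij_betw[symmetric, OF bij_betw_nth]) (use d in auto)
    finally show ?thesis by (simp add: mult.commute)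
  qed
  show ?thesis
    by (rule eq_matI)
      (auto simp: matrix_of_def scalar_prod_def atLeast0LessThan *[of "f (bs ! j)" "bs ! i" for i j])
qed

lemma matrix_of_id:
  assumes bs: "ordered_basis scale bs"
  shows "matrix_of scale bs id = 1\<^sub>m (length bs)"
proof -
  have ind: "independent (set bs)" and d: "distinct bs"
    using bs by (auto simp: ordered_basis_def is_basis_def)
  show ?thesis
    by (rule eq_matI) (auto simp: matrix_of_def representation_basis[OF ind] nth_eq_iff_index_eq[OF d])
qed

text \<open>
  The result does not mention \<open>bs\<close>, so for maps of this form the choice of the basis
  that is hidden in \<open>lin_det\<close> is harmless.
\<close>

lemma det_matrix_of_rank_one:
  assumes bs: "ordered_basis scale bs" and \<phi>: "Modules.module_hom scale (*) \<phi>"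
  shows "det (matrix_of scale bs (\<lambda>z. z + scale (\<phi> z) x)) = 1 + \<phi> x"
proof -
  interpret \<phi>: Modules.module_hom scale "(*)" \<phi> by fact
  let ?r = "representation (set bs)" and ?n = "length bs"
  let ?X = "mat ?n 1 (\<lambda>(i, j). ?r x (bs ! i))" and ?P = "mat 1 ?n (\<lambda>(i, j). \<phi> (bs ! j))"
  have ind: "independent (set bs)" and sp: "\<And>x. x \<in> span (set bs)" and d: "distinct bs"
    using bs by (auto simp: ordered_basis_def is_basis_def)
  have "matrix_of scale bs (\<lambda>z. z + scale (\<phi> z) x) = 1\<^sub>m ?n + ?X * ?P"
    by (rule eq_matI)
      (auto simp: matrix_of_def scalar_prod_def representation_add[OF ind sp sp]
        representation_scale[OF ind sp] representation_basis[OF ind] nth_eq_iff_index_eq[OF d] mult.commute)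
  moreover have "\<phi> x = (\<Sum>k<?n. \<phi> (bs ! k) * ?r x (bs ! k))"
  proof -
    have x: "x = (\<Sum>c\<in>set bs. scale (?r x c) c)"
      using sum_representation_eq[OF ind sp] by simp
    have "\<phi> x = (\<Sum>c\<in>set bs. \<phi> c * ?r x c)"
      by (subst x) (simp add: \<phi>.sum \<phi>.scale mult.commute)
    also have "\<dots> = (\<Sum>k<?n. \<phi> (bs ! k) * ?r x (bs ! k))"
      by (rule sum.reindex_bij_betw[symmetric, OF bij_betw_nth]) (use d in auto)
    finally show ?thesis .
  qed
  moreover have "det (1\<^sub>m ?n + ?X * ?P) = det (1\<^sub>m 1 + ?P * ?X)"
    by (rule det_one_plus_rank_one) auto
  moreover have "\<dots> = 1 + (\<Sum>k<?n. \<phi> (bs ! k) * ?r x (bs ! k))"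
    by (subst det_single) (auto simp: scalar_prod_def atLeast0LessThan)
  ultimately show ?thesis by simp
qed

lemma lin_det_eq:
  assumes "\<exists>bs. ordered_basis scale bs"
  obtains bs where "ordered_basis scale bs" "\<And>g. lin_det scale g = det (matrix_of scale bs g)"
  using that[OF someI_ex[OF assms]] unfolding lin_det_def by simp

lemma lin_det_comp:
  assumes "\<exists>bs. ordered_basis scale bs"
    and "Modules.module_hom scale scale f" "Modules.module_hom scale scale g"
  shows "lin_det scale (g \<circ> f) = lin_det scale g * lin_det scale f"
proof -
  obtain bs where bs: "ordered_basis scale bs" "\<And>g. lin_det scale g = det (matrix_of scale bs g)"
    using lin_det_eq[OF assms(1)] by blast
  show ?thesis
    unfolding bs(2) matrix_of_comp[OF bs(1) assms(2,3)]
    by (rule det_mult) (auto simp: matrix_of_def)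
qed

lemma lin_det_id:
  assumes "\<exists>bs. ordered_basis scale bs"
  shows "lin_det scale id = 1"
proof -
  obtain bs where bs: "ordered_basis scale bs" "\<And>g. lin_det scale g = det (matrix_of scale bs g)"
    using lin_det_eq[OF assms] by blast
  show ?thesis by (simp only: bs(2) matrix_of_id[OF bs(1)] det_one)
qed

lemma lin_det_rank_one:
  assumes "\<exists>bs. ordered_basis scale bs" and "Modules.module_hom scale (*) \<phi>"
  shows "lin_det scale (\<lambda>z. z + scale (\<phi> z) x) = 1 + \<phi> x"
proof -
  obtain bs where bs: "ordered_basis scale bs" "\<And>g. lin_det scale g = det (matrix_of scale bs g)"
    using lin_det_eq[OF assms(1)] by blast
  show ?thesis by (simp only: bs(2) det_matrix_of_rank_one[OF bs(1) assms(2)])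
qed

lemma module_hom_rank_one:
  assumes "Modules.module_hom scale (*) \<phi>"
  shows "Modules.module_hom scale scale (\<lambda>z. z + scale (\<phi> z) x)"
proof -
  interpret \<phi>: Modules.module_hom scale "(*)" \<phi> by fact
  show ?thesis
    by unfold_locales (simp_all add: algebra_simps \<phi>.add \<phi>.scale)
qed

lemma basis_vector_image:
  assumes "Modules.module_hom scale scale g" "bij g" "basis_vector scale x"
  shows "basis_vector scale (g x)"
proof -
  interpret g: Modules.module_hom scale scale g by fact
  obtain B where B: "independent B" "span B = UNIV" "x \<in> B"
    using assms(3) by (auto simp: basis_vector_def is_basis_def)
  have "independent (g ` B)"
    using g.independent_inj_image B(1) bij_is_inj[OF assms(2)] by blast
  moreover have "span (g ` B) = UNIV"
    using g.span_image[of B] B(2) bij_is_surj[OF assms(2)] by simp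
  ultimately have "is_basis scale (g ` B)" by (simp add: is_basis_def)
  moreover have "g x \<in> g ` B" using B(3) by simp
  ultimately show ?thesis unfolding basis_vector_def by (intro exI conjI)
qed

end

section \<open>Skew hermitian spaces with a symplectic basis\<close>

locale symplectic_space = Modules.module scale
  for scale :: "'s::comm_ring_1 \<Rightarrow> 'v::ab_group_add \<Rightarrow> 'v" +
  fixes star :: "'s \<Rightarrow> 's" and h :: "'v \<Rightarrow> 'v \<Rightarrow> 's"
    and m :: nat and u v :: "nat \<Rightarrow> 'v"
  assumes local_ring: "local_ring TYPE('s)"
    and involution: "ring_involution star"
    and skew: "skew_hermitian scale star h"
    and nondeg: "nondegenerate scale h"
    and sbasis: "symplectic_basis scale h m u v"
begin

lemma star_add: "star (a + b) = star a + star b"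
  and star_mult: "star (a * b) = star a * star b"
  and star_one: "star 1 = 1"
  and star_star: "star (star a) = a"
  using involution by (auto simp: ring_involution_def)

lemma star_zero: "star 0 = 0"
  using star_add[of 0 0] by simp

lemma star_minus: "star (- a) = - star a"
  using star_add[of a "- a"] star_zero by (simp add: eq_neg_iff_add_eq_0 add.commute)

lemma h_hom: "Modules.module_hom scale (*) (h x)"
  and h_add_left: "h (x + y) z = h x z + h y z"
  and star_h: "star (h x y) = - h y x"
  using skew by (auto simp: skew_hermitian_def)

lemma h_add_right: "h x (y + z) = h x y + h x z"
  and h_scale_right: "h x (scale a y) = a * h x y"
  and h_zero_right: "h x 0 = 0"
  and h_minus_right: "h x (- y) = - h x y"
  and h_diff_right: "h x (y - z) = h x y - h x z"
proof -
  interpret hx: Modules.module_hom scale "(*)" "h x" by (rule h_hom)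
  show "h x (y + z) = h x y + h x z" "h x (scale a y) = a * h x y"
    "h x 0 = 0" "h x (- y) = - h x y" "h x (y - z) = h x y - h x z"
    by (rule hx.add hx.scale hx.zero hx.neg hx.diff)+
qed

lemma h_swap: "h y x = - star (h x y)"
  by (simp add: star_h)

lemma h_scale_left: "h (scale a x) y = star a * h x y"
  by (metis h_swap h_scale_right star_mult mult_minus_right star_minus)

lemma h_zero_left: "h 0 y = 0"
  by (metis h_swap h_zero_right star_zero minus_zero)

lemma h_diff_left: "h (x - y) z = h x z - h y z"
  using h_add_left[of "x - y" y z] by simp

lemma h_minus_left: "h (- x) y = - h x y"
  using h_diff_left[of 0 x y] by (simp add: h_zero_left)

lemmas form_simps = h_minus_left h_add_left h_add_right h_diff_left h_diff_right h_minus_right h_scale_left h_scale_right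
  star_add star_mult star_one star_zero star_minus star_star star_h

lemma h_eq_0_swap: "h x y = 0 \<Longrightarrow> h y x = 0"
  by (metis h_swap star_zero minus_zero)

lemma module_hom_h_mult: "Modules.module_hom scale (*) (\<lambda>z. a * h x z)"
  by (simp add: module_hom_iff module_ring_mult module_axioms form_simps algebra_simps)

text \<open>
  A Boolean chooses between the two vectors of a hyperbolic pair, so that \<open>e b i\<close> and \<open>e (\<not> b) i\<close> are
  partners and the arguments below treat both kinds of basis vectors alike.
\<close>

definition e :: "bool \<Rightarrow> nat \<Rightarrow> 'v" where
  "e b i = (if b then u i else v i)"

lemma h_e:
  assumes "i < m" "j < m"
  shows "h (e b i) (e c j) = (if i = j \<and> b \<noteq> c then if b then 1 else - 1 else 0)"
proof -
  have uv: "h (u i) (v j) = (if i = j then 1 else 0)" "h (u j) (v i) = (if i = j then 1 else 0)"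
    and "h (u i) (u j) = 0" "h (v i) (v j) = 0"
    using sbasis assms by (auto simp: symplectic_basis_def)
  moreover have "h (v i) (u j) = (if i = j then - 1 else 0)"
    unfolding h_swap[of "v i"] uv(2) by (auto simp: star_one star_zero)
  ultimately show ?thesis by (cases "i = j") (simp_all add: e_def)
qed

lemma has_ordered_basis: "\<exists>bs. ordered_basis scale bs"
  using sbasis by (auto simp: symplectic_basis_def)

lemma is_basis_e: "is_basis scale {e b i | b i. i < m}"
proof -
  have "set (concat (map (\<lambda>i. [u i, v i]) [0..<m])) = {e b i | b i. i < m}"
    by (auto simp: set_eq_iff ex_bool_eq e_def)
  then show ?thesis
    using sbasis by (simp add: symplectic_basis_def ordered_basis_def)
qed

lemma basis_vector_e: "i < m \<Longrightarrow> basis_vector scale (e b i)"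
  using is_basis_e unfolding basis_vector_def by blast

lemma span_e: "span {e b i | b i. i < m} = UNIV"
  using is_basis_e by (simp add: is_basis_def)

text \<open>
  The pairing \<open>h (e b i) x\<close> is, up to sign, the coordinate of \<open>x\<close> at the partner of \<open>e b i\<close>.
  Vectors are compared through these pairings throughout, instead of through a basis expansion.
\<close>

lemma eq_by_coordinates:
  assumes "\<And>b i. i < m \<Longrightarrow> h (e b i) x = h (e b i) y"
  shows "x = y"
proof -
  have "h (x - y) z = h 0 z" for z
  proof -
    have "z \<in> span {e b i | b i. i < m}" by (simp add: span_e)
    then show ?thesis
    proof (induction z rule: span_induct)
      case base
      show ?case by (simp add: subspace_def form_simps h_zero_left h_zero_right)
    next
      case (step z)
      then obtain b i where "z = e b i" "i < m" by blast
      then have "h z (x - y) = 0" using assms by (simp add: h_diff_right)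
      then show ?case by (metis h_eq_0_swap h_zero_left)
    qed
  qed
  then have "x - y = 0"
    using nondeg unfolding nondegenerate_def bij_betw_def by (metis UNIV_I ext inj_onD)
  then show ?thesis by simp
qed

text \<open>
  If all pairings of \<open>z\<close> with the basis were nonunits, then so would be all its pairings, because
  the nonunits form an ideal.
\<close>

lemma unit_coordinate:
  assumes "h y z = 1"
  shows "\<exists>b i. i < m \<and> h (e b i) z dvd 1"
proof (rule ccontr)
  assume none: "\<not> (\<exists>b i. i < m \<and> h (e b i) z dvd 1)"
  have "y \<in> span {e b i | b i. i < m}" by (simp add: span_e)
  then have "\<not> h y z dvd 1"
  proof (induction y rule: span_induct)
    case base
    have "\<not> star c * h x z dvd 1" if "\<not> h x z dvd 1" for c x
      using that dvd_mult_right by blast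
    then show ?case
      by (auto simp: subspace_def form_simps h_zero_left dest: local_ring_nonunit_add[OF local_ring])
  next
    case (step y)
    then show ?case using none by blast
  qed
  then show False using assms by simp
qed

section \<open>The special unitary group\<close>

lemma unitary_iff:
  "g \<in> unitary_maps scale h \<longleftrightarrow>
    Modules.module_hom scale scale g \<and> bij g \<and> (\<forall>x y. h (g x) (g y) = h x y)"
  by (simp add: unitary_maps_def)

lemma unitary_id: "id \<in> unitary_maps scale h"
  by (simp add: unitary_iff module_hom_id)

lemma unitary_comp:
  "f \<in> unitary_maps scale h \<Longrightarrow> g \<in> unitary_maps scale h \<Longrightarrow> g \<circ> f \<in> unitary_maps scale h"
  by (simp add: unitary_iff module_hom_iff bij_comp)

lemma unitary_inv:
  assumes "g \<in> unitary_maps scale h"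
  shows "inv_into UNIV g \<in> unitary_maps scale h"
proof -
  have g: "Modules.module_hom scale scale g" "bij g" and hg: "\<And>x y. h (g x) (g y) = h x y"
    using assms by (auto simp: unitary_iff)
  interpret g: Modules.module_hom scale scale g by fact
  have gi: "g (inv_into UNIV g x) = x" for x using g(2) by (simp add: bij_is_surj surj_f_inv_f)
  have ig: "inv_into UNIV g (g x) = x" for x using g(2) by (simp add: bij_is_inj)
  have "inv_into UNIV g (x + y) = inv_into UNIV g x + inv_into UNIV g y" "inv_into UNIV g (scale a x) = scale a (inv_into UNIV g x)" for a x y
    by (metis gi ig g.add, metis gi ig g.scale)
  moreover have "h (inv_into UNIV g x) (inv_into UNIV g y) = h x y" for x y
    by (metis gi hg)
  ultimately show ?thesis
    using g(2) by (simp add: unitary_iff module_hom_iff module_axioms bij_imp_bij_inv)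
qed

lemma mem_SU: "g \<in> carrier (SU scale h) \<longleftrightarrow> g \<in> unitary_maps scale h \<and> lin_det scale g = 1"
  and SU_mult: "mult (SU scale h) = (\<circ>)"
  and SU_one: "one (SU scale h) = id"
  by (simp_all add: SU_def)

lemma SU_comp:
  "f \<in> carrier (SU scale h) \<Longrightarrow> g \<in> carrier (SU scale h) \<Longrightarrow> g \<circ> f \<in> carrier (SU scale h)"
  using lin_det_comp[OF has_ordered_basis] unitary_comp by (auto simp: mem_SU unitary_iff)

lemma SU_inv:
  assumes "g \<in> carrier (SU scale h)"
  shows "inv_into UNIV g \<in> carrier (SU scale h)" "inv_into UNIV g \<circ> g = id"
proof -
  have g: "g \<in> unitary_maps scale h" "lin_det scale g = 1" using assms by (auto simp: mem_SU)
  have i: "inv_into UNIV g \<in> unitary_maps scale h" by (rule unitary_inv) fact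
  show *: "inv_into UNIV g \<circ> g = id" using g by (simp add: unitary_iff bij_is_inj)
  have "lin_det scale (inv_into UNIV g) * lin_det scale g = 1"
    using lin_det_comp[OF has_ordered_basis, of g "inv_into UNIV g"] g i lin_det_id[OF has_ordered_basis]
    by (simp add: * unitary_iff)
  then show "inv_into UNIV g \<in> carrier (SU scale h)" using g i by (simp add: mem_SU)
qed

lemma group_SU: "group (SU scale h)"
proof (rule groupI)
  show "\<one>\<^bsub>SU scale h\<^esub> \<in> carrier (SU scale h)"
    by (simp add: mem_SU SU_one unitary_id lin_det_id[OF has_ordered_basis])
qed (use SU_comp SU_inv in \<open>auto simp: SU_mult SU_one comp_assoc intro!: bexI\<close>)

sublocale SU: group "SU scale h" by (rule group_SU)

section \<open>The group generated by the isotropic transvections\<close>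

lemma transvection_in_SU:
  assumes a: "star a = a" and x: "h x x = 0"
  shows "transvection scale h a x \<in> carrier (SU scale h)"
proof -
  let ?f = "\<lambda>a. transvection scale h a x"
  have *: "?f (- b) \<circ> ?f b = id" for b
    by (rule ext) (simp add: transvection_def form_simps x algebra_simps)
  have "bij (?f a)"
    using *[of a] *[of "- a"] by (intro o_bij[of "?f (- a)"]) auto
  moreover have "h (?f a y) (?f a z) = h y z" for y z
    by (simp add: transvection_def form_simps x a algebra_simps)
  moreover have "Modules.module_hom scale scale (?f a)"
    unfolding transvection_def by (rule module_hom_rank_one) (rule module_hom_h_mult)
  moreover have "lin_det scale (?f a) = 1"
    unfolding transvection_def
    by (simp add: lin_det_rank_one[OF has_ordered_basis module_hom_h_mult] x)
  ultimately show ?thesis by (simp add: mem_SU unitary_iff)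
qed

abbreviation T :: "('v \<Rightarrow> 'v) set" where
  "T \<equiv> generate (SU scale h) (isotropic_transvections scale star h)"

lemma transvections_subset_SU: "isotropic_transvections scale star h \<subseteq> carrier (SU scale h)"
  by (auto simp: isotropic_transvections_def fixed_ring_def transvection_in_SU)

lemma T_subset_SU: "T \<subseteq> carrier (SU scale h)"
  by (rule SU.generate_incl[OF transvections_subset_SU])

lemma T_comp: "f \<in> T \<Longrightarrow> g \<in> T \<Longrightarrow> g \<circ> f \<in> T"
  using generate.eng[of g "SU scale h" _ f] by (simp add: SU_mult)

lemma T_id: "id \<in> T"
  using generate.one[of "SU scale h"] by (simp add: SU_one)

text \<open>
  This form lets \<open>g\<close> be simplified by left multiplication with elements of \<open>T\<close>.
\<close>

lemma T_cancel:
  assumes t: "t \<in> T" and tg: "t \<circ> g \<in> T"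
  shows "g \<in> T"
proof -
  have "t \<in> carrier (SU scale h)" using t T_subset_SU by blast
  then have "m_inv (SU scale h) t = inv_into UNIV t"
    using SU_inv by (intro SU.inv_equality) (auto simp: SU_mult SU_one)
  moreover have "m_inv (SU scale h) t \<in> T"
    using SU.generate_m_inv_closed[OF transvections_subset_SU t] .
  ultimately have "inv_into UNIV t \<circ> (t \<circ> g) \<in> T" using T_comp[OF tg] by simp
  then show ?thesis
    using SU_inv(2)[OF \<open>t \<in> carrier _\<close>] by (simp flip: comp_assoc)
qed

lemma transvection_in_T:
  "star a = a \<Longrightarrow> basis_vector scale x \<Longrightarrow> h x x = 0 \<Longrightarrow> transvection scale h a x \<in> T"
  by (rule generate.incl) (auto simp: isotropic_transvections_def fixed_ring_def)

text \<open>
  For orthogonal isotropic \<open>x\<close> and \<open>y\<close> this is an Eichler (or Siegel) transformation: the short root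
  element of the unitary group, with transvections as the long ones.
\<close>

definition eichler :: "'v \<Rightarrow> 'v \<Rightarrow> 's \<Rightarrow> 'v \<Rightarrow> 'v" where
  "eichler x y s z = z + scale (s * h x z) y + scale (star s * h y z) x"

text \<open>
  The vector is the image of \<open>x\<close> under the automorphism \<open>z \<mapsto> z + s h(x',z) y\<close>, whose inverse has
  \<open>- s\<close> in place of \<open>s\<close>.
\<close>

lemma basis_vector_shear:
  assumes x: "basis_vector scale x" and x': "h x' x = 1" "h x' y = 0"
  shows "basis_vector scale (x + scale s y)"
proof -
  let ?g = "\<lambda>s z. z + scale (s * h x' z) y"
  have *: "?g (- b) \<circ> ?g b = id" for b
    by (rule ext) (simp add: form_simps x' algebra_simps)
  have bij: "bij (?g s)"
    using *[of s] *[of "- s"] by (intro o_bij[of "?g (- s)"]) auto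
  have "Modules.module_hom scale scale (?g s)"
    by (rule module_hom_rank_one) (rule module_hom_h_mult)
  from basis_vector_image[OF this bij x] show ?thesis by (simp add: x')
qed

text \<open>
  Expanding \<open>z + h(x + s y, z) (x + s y)\<close> gives the Eichler map together with the terms \<open>h(x,z) x\<close> and
  \<open>s s* h(y,z) y\<close>. Transvections along \<open>x\<close> and \<open>y\<close> cancel these, the second one with the parameter
  \<open>s s*\<close> in \<open>R\<close>. The vector \<open>x'\<close> is there to make \<open>x + s y\<close> a basis vector.
\<close>

lemma eichler_in_T:
  assumes iso: "h x x = 0" "h y y = 0" and perp: "h x y = 0"
    and bv: "basis_vector scale x" "basis_vector scale y"
    and x': "h x' x = 1" "h x' y = 0"
  shows "eichler x y s \<in> T"
proof -
  have perp': "h y x = 0" using perp by (rule h_eq_0_swap)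
  have "eichler x y s = transvection scale h 1 (x + scale s y) \<circ>
      (transvection scale h (- 1) x \<circ> transvection scale h (- (s * star s)) y)"
    by (rule ext) (simp add: eichler_def transvection_def form_simps iso perp perp' algebra_simps)
  moreover have "transvection scale h 1 (x + scale s y) \<in> T"
    using basis_vector_shear[OF bv(1) x'] by (intro transvection_in_T) (simp_all add: form_simps iso perp perp')
  moreover have "transvection scale h (- 1) x \<in> T" "transvection scale h (- (s * star s)) y \<in> T"
    using bv iso by (auto intro!: transvection_in_T simp: form_simps mult.commute)
  ultimately show ?thesis using T_comp by simp
qed

section \<open>Moving isotropic vectors\<close>

lemma T_unitary:
  assumes "t \<in> T"
  shows T_hom: "Modules.module_hom scale scale t" and h_T: "h (t x) (t y) = h x y"
  using assms T_subset_SU by (auto simp: mem_SU unitary_iff)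

text \<open>
  The elements of \<open>T\<close> that leave alone the hyperbolic pairs with index above \<open>k\<close>, which earlier steps
  of the reduction have already brought into place.
\<close>

definition Tfix :: "nat \<Rightarrow> ('v \<Rightarrow> 'v) set" where
  "Tfix k = {t \<in> T. \<forall>b j. k < j \<and> j < m \<longrightarrow> t (e b j) = e b j}"

lemma Tfix_comp: "f \<in> Tfix k \<Longrightarrow> g \<in> Tfix k \<Longrightarrow> g \<circ> f \<in> Tfix k"
  by (simp add: Tfix_def T_comp)

lemma Tfix_id: "id \<in> Tfix k"
  by (simp add: Tfix_def T_id)

lemma Tfix_T: "t \<in> Tfix k \<Longrightarrow> t \<in> T"
  by (simp add: Tfix_def)

lemma h_Tfix: "t \<in> Tfix k \<Longrightarrow> k < j \<Longrightarrow> j < m \<Longrightarrow> h (e b j) (t z) = h (e b j) z"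
  using h_T[of t "e b j" z] by (simp add: Tfix_def)

lemma transvection_in_Tfix:
  assumes "star a = a" "i \<le> k" "k < m"
  shows "transvection scale h a (e b i) \<in> Tfix k"
proof -
  have "transvection scale h a (e b i) \<in> T"
    using assms by (intro transvection_in_T basis_vector_e) (simp_all add: h_e)
  then show ?thesis using assms by (auto simp: Tfix_def transvection_def h_e)
qed

lemma eichler_in_Tfix:
  assumes "i \<le> k" "j \<le> k" "i \<noteq> j" "k < m"
  shows "eichler (e b i) (e c j) s \<in> Tfix k"
proof -
  have "eichler (e b i) (e c j) s \<in> T"
    by (rule eichler_in_T[where x' = "scale (if b then - 1 else 1) (e (\<not> b) i)"])
      (use assms in \<open>auto simp: h_e basis_vector_e form_simps\<close>)
  then show ?thesis
    using assms by (auto simp: Tfix_def eichler_def h_e)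
qed

text \<open>
  Since \<open>h (e b i) z\<close> is a unit, the Eichler maps for \<open>e b i\<close> and the two vectors of the pair \<open>j \<noteq> i\<close>
  can give the two pairings of \<open>z\<close> with this pair any values. Apart from these they change only the
  pairing with the partner of \<open>e b i\<close>, so the pairs can be treated one after the other.
\<close>

lemma match_coordinates:
  assumes k: "k < m" and i: "i \<le> k"
    and ew: "h (e b i) z = h (e b i) w" and unit: "h (e b i) z dvd 1"
    and J: "finite J" "J \<subseteq> {..k} - {i}"
  shows "\<exists>t\<in>Tfix k. t (e b i) = e b i \<and> (\<forall>c. \<forall>j\<in>J. h (e c j) (t z) = h (e c j) w)"
  using J
proof (induction J rule: finite_induct)
  case empty
  show ?case by (rule bexI[of _ id]) (simp_all add: Tfix_id)
next
  case (insert j J)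
  then have j: "j \<le> k" "i \<noteq> j" and J: "\<And>l. l \<in> J \<Longrightarrow> l \<le> k \<and> l \<noteq> i \<and> l \<noteq> j" by auto
  obtain t where t: "t \<in> Tfix k" "t (e b i) = e b i"
    and tz: "\<And>c l. l \<in> J \<Longrightarrow> h (e c l) (t z) = h (e c l) w"
    using insert by auto
  obtain d where d: "h (e b i) z * d = 1" using unit by (metis dvdE)
  have ez: "h (e b i) (t z) = h (e b i) z"
    using h_T[OF Tfix_T[OF t(1)], of "e b i" z] by (simp add: t(2))
  \<comment> \<open>The parameters that correct the pairings with the two vectors of pair \<open>j\<close>; \<open>d\<close> inverts \<open>h (e b i) z\<close>.\<close>
  define r where "r = (h (e True j) w - h (e True j) (t z)) * d"
  define s where "s = (h (e False j) (t z) - h (e False j) w) * d"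
  let ?E = "eichler (e b i) (e True j) s \<circ> eichler (e b i) (e False j) r"
  have rd: "r * h (e b i) z = h (e True j) w - h (e True j) (t z)"
    using d unfolding r_def by (metis mult.assoc mult.commute mult_1_right)
  have sd: "s * h (e b i) z = h (e False j) (t z) - h (e False j) w"
    using d unfolding s_def by (metis mult.assoc mult.commute mult_1_right)
  have "?E \<circ> t \<in> Tfix k"
    using t j k i by (intro Tfix_comp eichler_in_Tfix) auto
  moreover have "(?E \<circ> t) (e b i) = e b i"
    using t j k i by (simp add: eichler_def h_e)
  moreover have "h (e c l) ((?E \<circ> t) z) = h (e c l) w" if "l \<in> insert j J" for c l
  proof (cases "l = j")
    case True
    then show ?thesis
      using j k i by (cases c) (simp_all add: eichler_def form_simps h_e ez rd sd)
  next
    case False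
    then show ?thesis
      using that tz[of l c] J[of l] j k i by (simp add: eichler_def form_simps h_e)
  qed
  ultimately show ?case by blast
qed

text \<open>
  After the coordinates away from the pair \<open>i\<close> have been matched, \<open>w = y + l x\<close> for \<open>x = e b i\<close>, a scalar
  \<open>l\<close> and the image \<open>y\<close> of \<open>z\<close>. As \<open>y\<close> and \<open>w\<close> are isotropic, \<open>l* c = l c*\<close> where \<open>c = h(x,y)\<close>, which means
  that \<open>l / c\<close> is fixed by the involution. The transvection along \<open>x\<close> with this parameter maps \<open>y\<close> to
  \<open>w\<close>.
\<close>

lemma move_fixing:
  assumes k: "k < m" and i: "i \<le> k"
    and iso: "h z z = 0" "h w w = 0"
    and ew: "h (e b i) z = h (e b i) w" and unit: "h (e b i) z dvd 1"
    and above: "\<And>c j. k < j \<Longrightarrow> j < m \<Longrightarrow> h (e c j) z = h (e c j) w"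
  shows "\<exists>t\<in>Tfix k. t (e b i) = e b i \<and> t z = w"
proof -
  let ?e = "e b i"
  obtain t where t: "t \<in> Tfix k" "t ?e = ?e"
    and tz: "\<And>c j. j \<in> {..k} - {i} \<Longrightarrow> h (e c j) (t z) = h (e c j) w"
    using match_coordinates[OF k i ew unit, of "{..k} - {i}"] by auto
  define y where "y = t z"
  have ey: "h ?e y = h ?e w" and yy: "h y y = 0"
    using h_T[OF Tfix_T[OF t(1)]] t(2) ew iso by (metis y_def)+
  have agree: "h (e c j) y = h (e c j) w" if "j < m" "j \<noteq> i" for c j
  proof (cases "j \<le> k")
    case True
    then show ?thesis using tz that unfolding y_def by simp
  next
    case False
    then show ?thesis using above h_Tfix[OF t(1)] that unfolding y_def by simp
  qed
  \<comment> \<open>The sign is the value of \<open>h (e (\<not> b) i) (e b i)\<close>, which is its own inverse.\<close>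
  define l where "l = (if b then - 1 else 1) * (h (e (\<not> b) i) w - h (e (\<not> b) i) y)"
  have w: "w = y + scale l ?e"
  proof (rule eq_by_coordinates)
    fix c j assume "j < m"
    then show "h (e c j) w = h (e c j) (y + scale l ?e)"
      using agree[of j c] ey i k by (cases "j = i"; cases c; cases b) (auto simp: form_simps h_e l_def)
  qed
  obtain d where d: "h ?e y * d = 1" using unit ew ey by (metis dvdE)
  have sd: "star (h ?e y) * star d = 1" using d by (metis star_mult star_one)
  have "star l * h ?e y = l * star (h ?e y)"
  proof -
    have "h ?e ?e = 0" using i k by (simp add: h_e)
    then have "h w w = star l * h ?e y + l * h y ?e"
      unfolding w by (simp add: form_simps yy)
    then show ?thesis using iso(2) h_swap[of y ?e] by simp
  qed
  then have "star l * h ?e y * (d * star d) = l * star (h ?e y) * (d * star d)" by simp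
  then have "star l * star d * (h ?e y * d) = l * d * (star (h ?e y) * star d)"
    by (simp add: ac_simps)
  then have fixed: "star (l * d) = l * d" by (simp add: d sd star_mult)
  have "l * d * h ?e y = l" using d by (simp add: mult.assoc mult.commute[of d])
  then have "transvection scale h (l * d) ?e y = w" by (simp add: transvection_def w)
  moreover have "transvection scale h (l * d) ?e ?e = ?e"
    using i k by (simp add: transvection_def h_e)
  moreover have "transvection scale h (l * d) ?e \<circ> t \<in> Tfix k"
    using t(1) transvection_in_Tfix[OF fixed i k] by (rule Tfix_comp)
  ultimately show ?thesis using t(2) by (intro bexI[of _ "transvection scale h (l * d) ?e \<circ> t"]) (auto simp: y_def)
qed

text \<open>
  The detour goes through \<open>w = a e' + e d j\<close> with \<open>e'\<close> the partner of \<open>e b i\<close>: it is isotropic because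
  \<open>i \<noteq> j\<close>, it pairs with \<open>e b i\<close> like \<open>z\<close>, and it pairs with the partner of \<open>e d j\<close> like \<open>e d j\<close>.
\<close>

lemma move_to_basis_vector:
  assumes k: "k < m" and ij: "i \<le> k" "j \<le> k" "i \<noteq> j"
    and iso: "h z z = 0" and unit: "h (e b i) z dvd 1"
    and above: "\<And>c l. k < l \<Longrightarrow> l < m \<Longrightarrow> h (e c l) z = 0"
  shows "\<exists>t\<in>Tfix k. t z = e d j"
proof -
  define a where "a = (if b then 1 else - 1) * h (e b i) z"
  define w where "w = scale a (e (\<not> b) i) + e d j"
  have "\<exists>t\<in>Tfix k. t (e b i) = e b i \<and> t z = w"
    by (rule move_fixing[OF k ij(1) iso]) (use k ij unit above in \<open>auto simp: w_def a_def form_simps h_e\<close>)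
  then obtain t where t: "t \<in> Tfix k" "t z = w" by blast
  have "\<exists>t\<in>Tfix k. t (e (\<not> d) j) = e (\<not> d) j \<and> t w = e d j"
    by (rule move_fixing[OF k ij(2)]) (use k ij in \<open>auto simp: w_def form_simps h_e\<close>)
  then obtain t' where t': "t' \<in> Tfix k" "t' w = e d j" by blast
  show ?thesis
    using t t' Tfix_comp by (intro bexI[of _ "t' \<circ> t"]) auto
qed

text \<open>
  The preceding lemma needs a unit coordinate in a plane other than the target. If the one at hand is in
  the plane \<open>k\<close> itself, the vector is first sent to the plane \<open>0\<close>.
\<close>

lemma move_unimodular:
  assumes k: "0 < k" "k < m" and iso: "h z z = 0" and unit: "h y z = 1"
    and above: "\<And>c l. k < l \<Longrightarrow> l < m \<Longrightarrow> h (e c l) z = 0"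
  shows "\<exists>t\<in>Tfix k. t z = e True k"
proof -
  obtain b i where i: "i < m" "h (e b i) z dvd 1" using unit_coordinate[OF unit] by blast
  have "i \<le> k" 
  proof (rule ccontr)
    assume "\<not> i \<le> k"
    then have "0 dvd (1::'s)" using above[of i b] i by simp
    then show False by simp
  qed
  show ?thesis
  proof (cases "i = k")
    case False
    then show ?thesis using move_to_basis_vector[OF k(2) \<open>i \<le> k\<close> _ _ iso i(2) above] by blast
  next
    case True
    have "\<exists>t\<in>Tfix k. t z = e True 0"
      by (rule move_to_basis_vector[OF k(2) \<open>i \<le> k\<close> _ _ iso i(2) above]) (use k True in auto)
    then obtain t where t: "t \<in> Tfix k" "t z = e True 0" by blast
    have "\<exists>t\<in>Tfix k. t (e True 0) = e True k"
      by (rule move_to_basis_vector[OF k(2), of 0 k _ False]) (use k in \<open>auto simp: h_e\<close>)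
    then obtain t' where t': "t' \<in> Tfix k" "t' (e True 0) = e True k" by blast
    show ?thesis
      using t t' Tfix_comp by (intro bexI[of _ "t' \<circ> t"]) auto
  qed
qed

section \<open>The last hyperbolic plane\<close>

text \<open>
  The three moves are \<open>a U \<mapsto> a U + V \<mapsto> U + V \<mapsto> U\<close>, where \<open>U, V\<close> is the hyperbolic pair. They stay among
  isotropic vectors because \<open>a\<close> is in \<open>R\<close>: \<open>h(a U + V, a U + V) = a* - a\<close>.
\<close>

lemma rescale_in_T0:
  assumes m: "0 < m" and a: "star a = a" "a dvd 1"
  shows "\<exists>t\<in>Tfix 0. t (scale a (e True 0)) = e True 0"
proof -
  let ?U = "e True 0" and ?V = "e False 0"
  have "\<exists>t\<in>Tfix 0. t ?V = ?V \<and> t (scale a ?U) = scale a ?U + ?V"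
    by (rule move_fixing[OF m]) (use m a in \<open>auto simp: form_simps h_e\<close>)
  then obtain t1 where t1: "t1 \<in> Tfix 0" "t1 (scale a ?U) = scale a ?U + ?V" by blast
  have "\<exists>t\<in>Tfix 0. t ?U = ?U \<and> t (scale a ?U + ?V) = ?U + ?V"
    by (rule move_fixing[OF m]) (use m a in \<open>auto simp: form_simps h_e\<close>)
  then obtain t2 where t2: "t2 \<in> Tfix 0" "t2 (scale a ?U + ?V) = ?U + ?V" by blast
  have "\<exists>t\<in>Tfix 0. t ?V = ?V \<and> t (?U + ?V) = ?U"
    by (rule move_fixing[OF m]) (use m in \<open>auto simp: form_simps h_e\<close>)
  then obtain t3 where t3: "t3 \<in> Tfix 0" "t3 (?U + ?V) = ?U" by blast
  show ?thesis
    using t1 t2 t3 Tfix_comp by (intro bexI[of _ "t3 \<circ> (t2 \<circ> t1)"]) auto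
qed

text \<open>
  Such a map is a product of two maps that differ from the identity by rank one.
\<close>

lemma lin_det_diagonal:
  assumes m: "0 < m" and g: "Modules.module_hom scale scale g"
    and U: "g (e True 0) = scale a (e True 0)" and V: "g (e False 0) = scale d (e False 0)"
    and others: "\<And>c j. 0 < j \<Longrightarrow> j < m \<Longrightarrow> g (e c j) = e c j"
  shows "lin_det scale g = a * d"
proof -
  let ?U = "e True 0" and ?V = "e False 0"
  define A where "A z = z + scale ((1 - a) * h ?V z) ?U" for z
  define D where "D z = z + scale ((d - 1) * h ?U z) ?V" for z
  have homs: "Modules.module_hom scale scale A" "Modules.module_hom scale scale D"
    unfolding A_def D_def by (rule module_hom_rank_one, rule module_hom_h_mult)+
  have hAD: "Modules.module_hom scale scale (A \<circ> D)"
    using homs by (simp add: module_hom_iff)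
  have "g z = (A \<circ> D) z" for z
  proof -
    have "z \<in> span {e b i | b i. i < m}" by (simp add: span_e)
    then show ?thesis
    proof (induction z rule: span_induct)
      case base
      then show ?case
        using g hAD by (simp add: subspace_def module_hom_iff) (metis scale_zero_left)
    next
      case (step z)
      then obtain b i where z: "z = e b i" "i < m" by blast
      show ?case
      proof (cases "i = 0")
        case True
        then show ?thesis
          using m by (cases b) (simp_all add: z U V A_def D_def form_simps h_e algebra_simps)
      next
        case False
        then show ?thesis
          using z m by (simp add: others A_def D_def form_simps h_e)
      qed
    qed
  qed
  then have "g = A \<circ> D" by (rule ext)
  then have "lin_det scale g = lin_det scale A * lin_det scale D"
    using lin_det_comp[OF has_ordered_basis] homs by simp
  also have "lin_det scale A = a"
    unfolding A_def lin_det_rank_one[OF has_ordered_basis module_hom_h_mult] using m by (simp add: h_e)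
  also have "lin_det scale D = d"
    unfolding D_def lin_det_rank_one[OF has_ordered_basis module_hom_h_mult] using m by (simp add: h_e)
  finally show ?thesis .
qed

text \<open>
  Elements of \<open>T\<close> that act on this plane alone have determinant \<open>1\<close>, so they cannot change \<open>u\<^sub>0\<close> into
  \<open>a u\<^sub>0\<close> with a unit \<open>a\<close> outside \<open>R\<close>. The vector is therefore only brought to some \<open>a u\<^sub>0\<close>, and the
  determinant of \<open>g\<close> then shows that \<open>a\<close> is in \<open>R\<close>.
\<close>

lemma move_unimodular_plane:
  assumes m: "0 < m" and g: "g \<in> carrier (SU scale h)"
    and others: "\<And>c j. 0 < j \<Longrightarrow> j < m \<Longrightarrow> g (e c j) = e c j"
  shows "\<exists>t\<in>Tfix 0. t (g (e True 0)) = e True 0"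
proof -
  let ?U = "e True 0" and ?V = "e False 0"
  have hg: "h (g x) (g y) = h x y" for x y using g by (simp add: mem_SU unitary_iff)
  have perp: "h (e c j) (g (e b 0)) = 0" if "0 < j" "j < m" for b c j
    using hg[of "e c j" "e b 0"] others[of j c] that m by (simp add: h_e)
  have iso: "h (g (e b 0)) (g (e b 0)) = 0" for b
    using m by (simp add: hg h_e)
  have UV: "h (g ?U) (g ?V) = 1" "h (g ?V) (g ?U) = - 1" using m by (simp_all add: hg h_e)
  \<comment> \<open>Make the coordinate at \<open>U\<close> a unit: if it is not, the one at \<open>V\<close> is, and adding it helps.\<close>
  have "\<exists>t\<in>Tfix 0. h ?V (t (g ?U)) dvd 1"
  proof (cases "h ?V (g ?U) dvd 1")
    case True
    then show ?thesis by (intro bexI[of _ id]) (simp_all add: Tfix_id)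
  next
    case False
    have "h (- g ?V) (g ?U) = 1" using UV by (simp add: h_minus_left)
    then obtain b i where i: "i < m" "h (e b i) (g ?U) dvd 1"
      using unit_coordinate by blast
    have "i = 0"
    proof (rule ccontr)
      assume "i \<noteq> 0"
      then have "0 dvd (1::'s)" using perp[of i b True] i by simp
      then show False by simp
    qed
    then have unit: "h ?U (g ?U) dvd 1" using i False by (cases b) auto
    let ?f = "transvection scale h 1 ?U"
    have "h ?V (?f (g ?U)) = h ?V (g ?U) - h ?U (g ?U)"
      using m by (simp add: transvection_def form_simps h_e)
    then have "h ?V (g ?U) + (- h ?V (?f (g ?U))) = h ?U (g ?U)" by simp
    then have "h ?V (?f (g ?U)) dvd 1"
      using local_ring_nonunit_add[OF local_ring False, of "- h ?V (?f (g ?U))"] unit by auto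
    moreover have "?f \<in> Tfix 0" using m by (intro transvection_in_Tfix) (simp_all add: star_one)
    ultimately show ?thesis by blast
  qed
  then obtain t0 where t0: "t0 \<in> Tfix 0" and unit: "h ?V (t0 (g ?U)) dvd 1" by blast
  \<comment> \<open>The sign makes \<open>a U\<close> pair with \<open>V\<close> in the same way as the vector to be moved.\<close>
  define a where "a = - h ?V (t0 (g ?U))"
  have "\<exists>t\<in>Tfix 0. t ?V = ?V \<and> t (t0 (g ?U)) = scale a ?U"
    by (rule move_fixing[OF m])
      (use m unit perp h_Tfix[OF t0] h_T[OF Tfix_T[OF t0]] iso in \<open>auto simp: form_simps h_e a_def\<close>)
  then obtain t1 where t1: "t1 \<in> Tfix 0" "t1 (t0 (g ?U)) = scale a ?U" by blast
  let ?t = "t1 \<circ> t0"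
  have t: "?t \<in> Tfix 0" using t0 t1(1) by (rule Tfix_comp)
  define d where "d = h ?U (?t (g ?V))"
  \<comment> \<open>The form is preserved, hence \<open>a* d = 1\<close>; the determinant below gives \<open>a d = 1\<close>.\<close>
  have ad: "star a * d = 1"
    using h_T[OF Tfix_T[OF t], of "g ?U" "g ?V"] t1(2) UV(1) by (simp add: d_def form_simps)
  then have "d dvd 1" by (metis dvd_triv_right)
  have "\<exists>t\<in>Tfix 0. t ?U = ?U \<and> t (?t (g ?V)) = scale d ?V"
    by (rule move_fixing[OF m])
      (use m \<open>d dvd 1\<close> perp h_Tfix[OF t] h_T[OF Tfix_T[OF t]] iso in \<open>auto simp: form_simps h_e d_def\<close>)
  then obtain t2 where t2: "t2 \<in> Tfix 0" "t2 ?U = ?U" "t2 (?t (g ?V)) = scale d ?V" by blast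
  let ?s = "t2 \<circ> ?t"
  have s: "?s \<in> Tfix 0" using t t2(1) by (rule Tfix_comp)
  then have sg: "?s \<circ> g \<in> carrier (SU scale h)"
    using g T_subset_SU Tfix_T SU_comp by blast
  have sU: "?s (g ?U) = scale a ?U"
    using T_hom[OF Tfix_T[OF t2(1)]] t1(2) t2(2) by (simp add: module_hom_iff)
  have "lin_det scale (?s \<circ> g) = a * d"
    by (rule lin_det_diagonal[OF m]) (use sg sU t2(3) others s in \<open>auto simp: mem_SU unitary_iff Tfix_def\<close>)
  then have "a * d = 1" using sg by (simp add: mem_SU)
  then have "star a = a" "a dvd 1"
    using ad by (metis mult.assoc mult.commute mult_1_right) (metis \<open>a * d = 1\<close> dvd_triv_left)
  then obtain t3 where "t3 \<in> Tfix 0" "t3 (scale a ?U) = ?U" using rescale_in_T0[OF m] by blast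
  then show ?thesis
    using s sU Tfix_comp by (intro bexI[of _ "t3 \<circ> ?s"]) auto
qed

section \<open>Generation by transvections\<close>

text \<open>
  Once \<open>g u\<^sub>k\<close> has been moved back to \<open>u\<^sub>k\<close>, the image of \<open>v\<^sub>k\<close> is an isotropic vector that pairs to \<open>1\<close>
  with \<open>u\<^sub>k\<close>, like \<open>v\<^sub>k\<close>, so it can be moved to \<open>v\<^sub>k\<close> without disturbing \<open>u\<^sub>k\<close>.
\<close>

lemma SU_fixing_in_T:
  assumes "k \<le> m" and "g \<in> carrier (SU scale h)"
    and "\<And>b i. k \<le> i \<Longrightarrow> i < m \<Longrightarrow> g (e b i) = e b i"
  shows "g \<in> T"
  using assms
proof (induction k arbitrary: g)
  case 0
  have "g x = x" for x
  proof (rule eq_by_coordinates)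
    fix b i assume "i < m"
    then have "g (e b i) = e b i" using 0 by simp
    then show "h (e b i) (g x) = h (e b i) x"
      using 0(2) unfolding mem_SU unitary_iff by metis
  qed
  then have "g = id" by auto
  then show ?case using T_id by metis
next
  case (Suc k)
  let ?U = "e True k" and ?V = "e False k"
  have k: "k < m" using Suc.prems(1) by simp
  have hg: "h (g x) (g y) = h x y" for x y using Suc.prems(2) by (simp add: mem_SU unitary_iff)
  have above: "h (e c j) (g (e b k)) = 0" if "k < j" "j < m" for b c j
    using hg[of "e c j" "e b k"] Suc.prems(3)[of j c] that k by (simp add: h_e)
  have iso: "h (g (e b k)) (g (e b k)) = 0" for b
    using k by (simp add: hg h_e)
  have "\<exists>t\<in>Tfix k. t (g ?U) = ?U"
  proof (cases "k = 0")
    case True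
    then show ?thesis using move_unimodular_plane[of g] k Suc.prems by simp
  next
    case False
    have "h (g (- ?V)) (g ?U) = 1"
      unfolding hg using k by (simp add: h_e h_minus_left)
    then show ?thesis using move_unimodular[OF _ k iso _ above] False by blast
  qed
  then obtain t where t: "t \<in> Tfix k" "t (g ?U) = ?U" by blast
  have tT: "h (t x) (t y) = h x y" for x y using h_T[OF Tfix_T[OF t(1)]] .
  have "h ?U (t (g ?V)) = h (t (g ?U)) (t (g ?V))" by (simp add: t(2))
  also have "\<dots> = 1" using k by (simp add: tT hg h_e)
  finally have "\<exists>s\<in>Tfix k. s ?U = ?U \<and> s (t (g ?V)) = ?V"
    by (intro move_fixing[OF k]) (use k above iso h_Tfix[OF t(1)] in \<open>auto simp: tT h_e\<close>)
  then obtain s where s: "s \<in> Tfix k" "s ?U = ?U" "s (t (g ?V)) = ?V" by blast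
  have st: "s \<circ> t \<in> Tfix k" using t(1) s(1) by (rule Tfix_comp)
  have "s \<circ> t \<circ> g \<in> T"
  proof (rule Suc.IH)
    show "s \<circ> t \<circ> g \<in> carrier (SU scale h)"
      using Suc.prems(2) Tfix_T[OF st] T_subset_SU SU_comp by blast
    show "(s \<circ> t \<circ> g) (e b i) = e b i" if "k \<le> i" "i < m" for b i
    proof (cases "i = k")
      case True
      then show ?thesis using t(2) s by (cases b) simp_all
    next
      case False
      then show ?thesis using that Suc.prems(3)[of i b] st by (simp add: Tfix_def)
    qed
  qed (use k in simp)
  then show ?case using Tfix_T[OF st] T_cancel by blast
qed

lemma SU_eq_T: "carrier (SU scale h) = T"
  using SU_fixing_in_T[of m] T_subset_SU by auto

end

theorem theorem9p2:
  fixes scale :: "'s::comm_ring_1 \<Rightarrow> 'v::ab_group_add \<Rightarrow> 'v"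
    and star :: "'s \<Rightarrow> 's"
    and h :: "'v \<Rightarrow> 'v \<Rightarrow> 's"
    and m :: nat
  assumes "local_ring TYPE('s)"
    and "ring_involution star"
    and "Modules.module scale"
    and "m \<ge> 1"
    and "free_of_rank scale (2 * m)"
    and "skew_hermitian scale star h"
    and "nondegenerate scale h"
    and "\<exists>u v. symplectic_basis scale h m u v"
  shows "generating_set (SU scale h) (isotropic_transvections scale star h)"
proof -
  obtain u v where "symplectic_basis scale h m u v" using assms(8) by blast
  then interpret symplectic_space scale star h m u v
    using assms by (intro symplectic_space.intro symplectic_space_axioms.intro)
  show ?thesis
    unfolding generating_set_def using transvections_subset_SU SU_eq_T by simp
qed

end
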